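(* Let $b\neq 0$ be a real number and let $(x_n)_{n\ge -4}$ be a well-defined real solution of the difference equation $$x_{n+1}=\frac{x_{n}x_{n-2}x_{n-4}}{x_{n-1}x_{n-3}\,(1+b\,x_{n}x_{n-2}x_{n-4})},\qquad n=0,1,2,\dots$$ Then $\lim_{n\to\infty}x_n=0$.
   Context: A solution $(x_n)_{n\ge -4}$ with real initial values $x_{-4},x_{-3},x_{-2},x_{-1},x_0$ is called well-defined if for every $n\ge 0$ the denominator $x_{n-1}x_{n-3}(1+b\,x_nx_{n-2}x_{n-4})$ is non-zero, so that all terms are defined by the recurrence. *)

theory Defs
  imports Complex_Main
begin

text \<open>
  Sequences \<open>(x\<^sub>n)\<close> with \<open>n \<ge> -4\<close> are functions on the integers; the values at
  arguments below \<open>-4\<close> are never referred to.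
\<close>

definition denom :: "real \<Rightarrow> (int \<Rightarrow> real) \<Rightarrow> int \<Rightarrow> real" where
  "denom b x n = x (n - 1) * x (n - 3) * (1 + b * x n * x (n - 2) * x (n - 4))"

text \<open>
  As division by zero yields \<open>0\<close> in HOL, the recurrence equation alone does not force
  its denominators to be non-zero, so this is a separate conjunct.
\<close>

definition well_defined_solution :: "real \<Rightarrow> (int \<Rightarrow> real) \<Rightarrow> bool" where
  "well_defined_solution b x \<longleftrightarrow>
     (\<forall>n\<ge>0. denom b x n \<noteq> 0 \<and> x (n + 1) = x n * x (n - 2) * x (n - 4) / denom b x n)"

end

theory Submission imports Defs begin

text \<open>
  The equation is a telescoping one in disguise. In terms of the products
  \<open>y\<^sub>n = x\<^sub>n x\<^sub>n\<^sub>-\<^sub>2 x\<^sub>n\<^sub>-\<^sub>4\<close> it reads \<open>y\<^sub>n\<^sub>+\<^sub>1 = y\<^sub>n / (1 + b y\<^sub>n)\<close>, so the reciprocals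
  \<open>1 / y\<^sub>n\<close> form an arithmetic progression with difference \<open>b\<close>
  (\<open>inverse_triple_product_linear\<close>). Two of the three factors of \<open>y\<^sub>n\<^sub>+\<^sub>6\<close> and \<open>y\<^sub>n\<^sub>+\<^sub>4\<close> agree,
  hence \<open>x\<^sub>n\<^sub>+\<^sub>6 / x\<^sub>n = y\<^sub>n\<^sub>+\<^sub>6 / y\<^sub>n\<^sub>+\<^sub>4 = t / (t + 2)\<close>, where \<open>t = n + d\<close> for a constant \<open>d\<close>.

  Along each residue class modulo 6 the solution is thus a product of factors
  \<open>1 - 2 / (t + 2)\<close>, which decays like \<open>n powr (-1/3)\<close> because \<open>t\<close> grows by 6 from one factor
  to the next. To see this without infinite products, observe that
  \<open>\<bar>x\<^sub>n\<bar>\<^sup>3 (n + d)\<close> does not increase when \<open>n\<close> is replaced by \<open>n + 6\<close>,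
  as soon as \<open>n + d > 0\<close>. It is therefore bounded,
  and \<open>\<bar>x\<^sub>n\<bar>\<^sup>3\<close> is at most a constant divided by \<open>n + d\<close>
  (\<open>tendsto_zero_if_shift_ratio\<close>).
\<close>

text \<open>
  The cube is the right power since \<open>(t / (t + 2))\<^sup>3\<close> and \<open>t / (t + 6)\<close> agree to
  first order in \<open>1 / t\<close>.
\<close>

lemma cube_ratio_le:
  fixes t :: real
  assumes "t > 0"
  shows "(t / (t + 2)) ^ 3 * (t + 6) \<le> t"
proof -
  have "t ^ 3 * (t + 6) \<le> t * (t + 2) ^ 3"
    using assms by (simp add: power3_eq_cube algebra_simps)
  then show ?thesis
    using assms by (simp add: power_divide pos_divide_le_eq)
qed

text \<open>
  A bound on one full period propagates to all later indices, one residue class at a time.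
\<close>

lemma bounded_above_if_shift_nonincreasing:
  fixes w :: "nat \<Rightarrow> real"
  assumes "p > 0" and step: "\<And>n. n \<ge> N \<Longrightarrow> w (n + p) \<le> w n"
  shows "\<exists>M. \<forall>n\<ge>N. w n \<le> M"
proof -
  define M where "M = Max (w ` {N..<N + p})"
  have "w n \<le> M" if "n \<ge> N" for n
    using that
  proof (induction n rule: less_induct)
    case (less n)
    show ?case
    proof (cases "n < N + p")
      case True
      then show ?thesis
        using less.prems by (auto simp: M_def intro!: Max_ge)
    next
      case False
      then have "w n \<le> w (n - p)" "w (n - p) \<le> M"
        using step[of "n - p"] less.IH[of "n - p"] \<open>p > 0\<close> by auto
      then show ?thesis by linarith
    qed
  qed
  then show ?thesis by blast
qed

lemma tendsto_zero_if_shift_ratio: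
  fixes s :: "nat \<Rightarrow> real" and d :: real
  assumes ratio: "\<And>n. s (n + 6) * (real n + d + 2) = s n * (real n + d)"
  shows "s \<longlonglongrightarrow> 0"
proof -
  define w where "w n = \<bar>s n\<bar> ^ 3 * (real n + d)" for n
  obtain N :: nat where N: "real N > - d"
    using reals_Archimedean2 by blast
  have pos: "real n + d > 0" if "n \<ge> N" for n
    using N that by linarith
  have "w (n + 6) \<le> w n" if "n \<ge> N" for n
  proof -
    define t where "t = real n + d"
    have t: "t > 0" using pos[OF that] by (simp add: t_def)
    have "s (n + 6) = s n * (t / (t + 2))"
      using ratio[of n] t by (simp add: t_def field_simps)
    then have abs_ratio: "\<bar>s (n + 6)\<bar> = \<bar>s n\<bar> * (t / (t + 2))"
      using t by (simp add: abs_mult)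
    have "w (n + 6) = \<bar>s (n + 6)\<bar> ^ 3 * (t + 6)"
      by (simp add: w_def t_def add_ac)
    also have "\<dots> = \<bar>s n\<bar> ^ 3 * ((t / (t + 2)) ^ 3 * (t + 6))"
      by (simp only: abs_ratio power_mult_distrib mult.assoc)
    also have "\<dots> \<le> \<bar>s n\<bar> ^ 3 * t"
      by (intro mult_left_mono cube_ratio_le t) simp
    finally show ?thesis by (simp add: w_def t_def)
  qed
  then obtain M where M: "\<And>n. n \<ge> N \<Longrightarrow> w n \<le> M"
    using bounded_above_if_shift_nonincreasing[of 6 N w] by auto
  have "filterlim (\<lambda>n. d + real n) at_top sequentially"
    by (intro filterlim_tendsto_add_at_top[OF tendsto_const] filterlim_real_sequentially)
  then have lim: "(\<lambda>n. M / (d + real n)) \<longlonglongrightarrow> 0"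
    by (intro tendsto_divide_0[OF tendsto_const] filterlim_at_top_imp_at_infinity)
  have "(\<lambda>n. \<bar>s n\<bar> ^ 3) \<longlonglongrightarrow> 0"
  proof (rule tendsto_sandwich[OF _ _ tendsto_const lim])
    show "\<forall>\<^sub>F n in sequentially. \<bar>s n\<bar> ^ 3 \<le> M / (d + real n)"
      using eventually_ge_at_top[of N]
    proof eventually_elim
      case (elim n)
      then show ?case
        using M[OF elim] pos[OF elim] by (simp add: w_def pos_le_divide_eq add.commute)
    qed
  qed simp
  then have "(\<lambda>n. root 3 (\<bar>s n\<bar> ^ 3)) \<longlonglongrightarrow> root 3 0"
    by (rule tendsto_real_root)
  then show ?thesis
    by (simp add: real_root_power_cancel tendsto_rabs_zero_iff)
qed

definition triple_product :: "(int \<Rightarrow> real) \<Rightarrow> int \<Rightarrow> real" where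
  "triple_product x n = x n * x (n - 2) * x (n - 4)"

text \<open>
  Every term from index \<open>-3\<close> on occurs as a factor of some denominator. The initial
  value at \<open>-4\<close> does not, but if it vanished, so would the term at \<open>1\<close>.
\<close>

lemma solution_nonzero:
  assumes sol: "well_defined_solution b x" and "n \<ge> -4"
  shows "x n \<noteq> 0"
proof -
  have denom: "denom b x m \<noteq> 0" if "m \<ge> 0" for m
    using sol that by (simp add: well_defined_solution_def)
  have tail: "x m \<noteq> 0" if "m \<ge> -3" for m
    using denom[of "m + 3"] that by (auto simp: denom_def)
  have "x 1 = x 0 * x (- 2) * x (- 4) / denom b x 0"
    using sol by (force simp: well_defined_solution_def)
  then have "x (- 4) \<noteq> 0"
    using tail[of 1] by auto
  then show ?thesis
    using tail \<open>n \<ge> -4\<close> by (cases "n = -4") auto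
qed

lemma triple_product_nonzero:
  assumes "well_defined_solution b x" and "n \<ge> 0"
  shows "triple_product x n \<noteq> 0"
  using assms by (simp add: triple_product_def solution_nonzero)

text \<open>
  Multiplying the recurrence by \<open>x\<^sub>n\<^sub>-\<^sub>1 x\<^sub>n\<^sub>-\<^sub>3\<close> turns its left-hand side into the next
  triple product; taking reciprocals then makes it additive.
\<close>

lemma inverse_triple_product_step:
  assumes sol: "well_defined_solution b x" and "n \<ge> 0"
  shows "1 / triple_product x (n + 1) = 1 / triple_product x n + b"
proof -
  define y where "y = triple_product x n"
  define q where "q = x (n - 1) * x (n - 3)"
  have denom: "denom b x n = q * (1 + b * y)"
    by (simp add: denom_def q_def y_def triple_product_def mult.assoc)
  have nz: "q \<noteq> 0" "1 + b * y \<noteq> 0" "y \<noteq> 0"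
    using sol \<open>n \<ge> 0\<close> denom triple_product_nonzero[OF sol, of n]
    by (auto simp: well_defined_solution_def y_def)
  have "x (n + 1) = y / (q * (1 + b * y))"
    using sol \<open>n \<ge> 0\<close> denom by (simp add: well_defined_solution_def y_def triple_product_def)
  moreover have "triple_product x (n + 1) = x (n + 1) * q"
    by (simp add: triple_product_def q_def mult.assoc)
  ultimately have "triple_product x (n + 1) = y / (1 + b * y)"
    using nz by simp
  then show ?thesis
    using nz by (simp add: y_def[symmetric] add_divide_distrib)
qed

lemma inverse_triple_product_linear:
  assumes sol: "well_defined_solution b x"
  shows "1 / triple_product x (int n) = 1 / triple_product x 0 + b * real n"
proof (induction n)
  case (Suc n)
  then show ?case
    using inverse_triple_product_step[OF sol, of "int n"] by (simp add: algebra_simps)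
qed simp

theorem theorem6:
  fixes b :: real and x :: "int \<Rightarrow> real"
  assumes "b \<noteq> 0"
    and "well_defined_solution b x"
  shows "(\<lambda>n::nat. x (int n)) \<longlonglongrightarrow> 0"
proof -
  let ?y = "triple_product x"
  \<comment> \<open>chosen such that \<open>1 / y\<^sub>n\<^sub>+\<^sub>4 = b (n + d)\<close>\<close>
  define d where "d = 1 / (b * ?y 0) + 4"
  have "x (int (n + 6)) * (real n + d + 2) = x (int n) * (real n + d)" for n :: nat
  proof -
    have y4: "1 / ?y (int n + 4) = b * (real n + d)"
      using inverse_triple_product_linear[OF assms(2), of "n + 4"] \<open>b \<noteq> 0\<close>
      by (simp add: d_def algebra_simps)
    have y6: "1 / ?y (int n + 6) = b * (real n + d + 2)"
      using inverse_triple_product_linear[OF assms(2), of "n + 6"] \<open>b \<noteq> 0\<close>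
      by (simp add: d_def algebra_simps)
    have nz: "?y (int n + 4) \<noteq> 0" "?y (int n + 6) \<noteq> 0"
      using triple_product_nonzero[OF assms(2)] by simp_all
    have "x (int n + 6) * ?y (int n + 4) = x (int n) * ?y (int n + 6)"
      by (simp add: triple_product_def add.commute)
    then have "x (int n + 6) * (1 / ?y (int n + 6)) = x (int n) * (1 / ?y (int n + 4))"
      using nz by (simp add: field_simps)
    then have "b * (x (int n + 6) * (real n + d + 2)) = b * (x (int n) * (real n + d))"
      unfolding y4 y6 by (simp only: mult.left_commute)
    then show ?thesis
      using \<open>b \<noteq> 0\<close> by simp
  qed
  then show ?thesis
    by (rule tendsto_zero_if_shift_ratio)
qed

end
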